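(* Let $f_i:\mathbb{R}^d\to\mathbb{R}$ be differentiable, bounded from below, convex and $L_i$-smooth with $L_i>0$. Let $\gamma>0$ and $x_k\in\mathbb{R}^d$. Consider Nesterov's accelerated gradient descent applied to $A(z)=f_i(z)+\frac1{2\gamma}\|z-x_k\|^2$, with step size $\eta_i=\frac{\gamma}{1+\gamma L_i}$ and momentum parameter $\alpha_i=\frac{\sqrt{1+\gamma L_i}-1}{\sqrt{1+\gamma L_i}+1}$, started at $z_0=z_{-1}=x_k$: $$y_{t+1}=z_t+\alpha_i(z_t-z_{t-1}),\qquad z_{t+1}=y_{t+1}-\eta_i\nabla A(y_{t+1}),\qquad t=0,1,2,\dots.$$ Then: (a) for every $\varepsilon_1>0$, the number of iterations $t$ needed to obtain $\|z_t-\mathrm{prox}_{\gamma f_i}(x_k)\|^2\le\varepsilon_1$ is $$\mathcal{O}\left(\sqrt{1+\gamma L_i}\,\log\left(\frac{(1+\gamma L_i)\,\|x_k-\mathrm{prox}_{\gamma f_i}(x_k)\|^2}{\varepsilon_1}\right)\right);$$ (b) for every $\varepsilon_2\in(0,1)$, the number of iterations $t$ needed to obtain $\|z_t-\mathrm{prox}_{\gamma f_i}(x_k)\|^2\le\varepsilon_2\|x_k-\mathrm{prox}_{\gamma f_i}(x_k)\|^2$ is $$\mathcal{O}\left(\sqrt{1+\gamma L_i}\,\log\left(\frac{1+\gamma L_i}{\varepsilon_2}\right)\right).$$ Here "the number of iterations needed is $\mathcal{O}(Q)$" means: there is an absolute constant $C>0$ (independent of all the data $d,f_i,L_i,\gamma,x_k,\varepsilon_1,\varepsilon_2$)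 such that the required inequality is attained at some integer $t$ with $0\le t\le \max\{0,\lceil C\,Q\rceil\}$.
   Context: $\|\cdot\|$ is the Euclidean norm. $f_i$ is $L_i$-smooth if $f_i(x)-f_i(y)-\langle\nabla f_i(y),x-y\rangle\le\frac{L_i}2\|x-y\|^2$ for all $x,y\in\mathbb{R}^d$. The proximal operator is $\mathrm{prox}_{\gamma f_i}(x)=\arg\min_{z\in\mathbb{R}^d}\{f_i(z)+\frac1{2\gamma}\|z-x\|^2\}$. Convention: $\log 0=-\infty$ (so that the bound is $t=0$ in that case). *)

theory Defs
  imports "HOL-Analysis.Analysis"
begin

text \<open>
  The constant hidden in the \<open>O\<close>-bound must not depend on the dimension \<open>d\<close>, so \<open>d\<close> has to be
  quantified inside the statement and \<open>real ^ 'n\<close> cannot be used. All the spaces \<open>R^d\<close> are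
  therefore realised inside a single inner product space, the finitely supported real sequences
  with the Euclidean inner product: \<open>R^d\<close> is the set \<open>Rd d\<close> of sequences vanishing from index \<open>d\<close>
  on. The library notions of inner product, norm, convexity and derivative (within \<open>Rd d\<close>)
  then restrict to the usual ones on \<open>R^d\<close>; see \<open>inner_Rd\<close> and \<open>norm_Rd\<close>.
\<close>

typedef finseq = "{x :: nat \<Rightarrow> real. finite {i. x i \<noteq> 0}}"
  morphisms coord Abs_finseq
  by (rule exI[of _ "\<lambda>_. 0"]) simp

setup_lifting type_definition_finseq

lemma finite_coord [simp]: "finite {i. coord x i \<noteq> 0}"
  using coord[of x] by simp

lemma finseq_eqI: "(\<And>i. coord x i = coord y i) \<Longrightarrow> x = y"
  by (simp add: coord_inject[symmetric] ext)

instantiation finseq :: real_vector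
begin

lift_definition zero_finseq :: finseq is "\<lambda>_. 0" by simp

lift_definition plus_finseq :: "finseq \<Rightarrow> finseq \<Rightarrow> finseq" is "\<lambda>x y i. x i + y i"
proof -
  fix x y :: "nat \<Rightarrow> real"
  assume "finite {i. x i \<noteq> 0}" "finite {i. y i \<noteq> 0}"
  then show "finite {i. x i + y i \<noteq> 0}"
    by (rule finite_subset[OF _ finite_UnI, rotated]) auto
qed

lift_definition uminus_finseq :: "finseq \<Rightarrow> finseq" is "\<lambda>x i. - x i" by simp

lift_definition minus_finseq :: "finseq \<Rightarrow> finseq \<Rightarrow> finseq" is "\<lambda>x y i. x i - y i"
proof -
  fix x y :: "nat \<Rightarrow> real"
  assume "finite {i. x i \<noteq> 0}" "finite {i. y i \<noteq> 0}"
  then show "finite {i. x i - y i \<noteq> 0}"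
    by (rule finite_subset[OF _ finite_UnI, rotated]) auto
qed

lift_definition scaleR_finseq :: "real \<Rightarrow> finseq \<Rightarrow> finseq" is "\<lambda>c x i. c * x i"
  by (erule finite_subset[rotated]) auto

instance
  by standard (transfer; simp add: algebra_simps)+

end

lemma coord_simps [simp]:
  "coord 0 i = 0"
  "coord (x + y) i = coord x i + coord y i"
  "coord (- x) i = - coord x i"
  "coord (x - y) i = coord x i - coord y i"
  "coord (c *\<^sub>R x) i = c * coord x i"
  by (transfer; simp)+

instantiation finseq :: real_inner
begin

definition inner_finseq :: "finseq \<Rightarrow> finseq \<Rightarrow> real" where
  "inner x y = (\<Sum>i | coord x i \<noteq> 0. coord x i * coord y i)"

definition norm_finseq :: "finseq \<Rightarrow> real" where
  "norm (x :: finseq) = sqrt (inner x x)"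

definition sgn_finseq :: "finseq \<Rightarrow> finseq" where
  "sgn (x :: finseq) = x /\<^sub>R norm x"

definition dist_finseq :: "finseq \<Rightarrow> finseq \<Rightarrow> real" where
  "dist (x :: finseq) y = norm (x - y)"

definition uniformity_finseq :: "(finseq \<times> finseq) filter" where
  "uniformity = (INF e\<in>{0<..}. principal {(x :: finseq, y). dist x y < e})"

definition open_finseq :: "finseq set \<Rightarrow> bool" where
  "open (U :: finseq set) \<longleftrightarrow> (\<forall>x\<in>U. \<forall>\<^sub>F (x', y) in uniformity. x' = x \<longrightarrow> y \<in> U)"

lemma inner_finseq_superset:
  assumes "finite I" "{i. coord x i \<noteq> 0} \<subseteq> I"
  shows "inner x y = (\<Sum>i\<in>I. coord x i * coord y i)"
  unfolding inner_finseq_def using assms by (intro sum.mono_neutral_left) auto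

instance
proof
  fix x y z :: finseq and r :: real
  define I where "I = {i. coord x i \<noteq> 0} \<union> {i. coord y i \<noteq> 0}"
  have I: "finite I" "{i. coord x i \<noteq> 0} \<subseteq> I" "{i. coord y i \<noteq> 0} \<subseteq> I"
    "{i. coord (x + y) i \<noteq> 0} \<subseteq> I" "{i. coord (r *\<^sub>R x) i \<noteq> 0} \<subseteq> I"
    by (auto simp: I_def)
  note inner_I = inner_finseq_superset[OF I(1) I(2)] inner_finseq_superset[OF I(1) I(3)]
    inner_finseq_superset[OF I(1) I(4)] inner_finseq_superset[OF I(1) I(5)]
  show "inner x y = inner y x"
    by (simp add: inner_I mult.commute)
  show "inner (x + y) z = inner x z + inner y z"
    by (simp add: inner_I distrib_right sum.distrib)
  show "inner (r *\<^sub>R x) y = r * inner x y"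
    by (simp add: inner_I sum_distrib_left mult.assoc)
  show "0 \<le> inner x x"
    by (simp add: inner_finseq_def sum_nonneg)
  show "inner x x = 0 \<longleftrightarrow> x = 0"
  proof
    assume "inner x x = 0"
    then have "\<forall>i\<in>{i. coord x i \<noteq> 0}. coord x i * coord x i = 0"
      unfolding inner_finseq_def by (subst (asm) sum_nonneg_eq_0_iff) auto
    then show "x = 0" by (intro finseq_eqI) auto
  qed (simp add: inner_finseq_def)
qed (simp_all add: norm_finseq_def sgn_finseq_def dist_finseq_def uniformity_finseq_def
      open_finseq_def)

end

definition Rd :: "nat \<Rightarrow> finseq set" where
  "Rd d = {x. \<forall>i\<ge>d. coord x i = 0}"

lemma subspace_Rd: "subspace (Rd d)"
  by (auto simp: subspace_def Rd_def)

lemma inner_Rd: "x \<in> Rd d \<Longrightarrow> x \<bullet> y = (\<Sum>i<d. coord x i * coord y i)"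
  by (rule inner_finseq_superset) (auto simp: Rd_def not_le[symmetric])

lemma norm_Rd: "x \<in> Rd d \<Longrightarrow> norm x = sqrt (\<Sum>i<d. (coord x i)\<^sup>2)"
  by (simp add: norm_eq_sqrt_inner inner_Rd power2_eq_square)

lemma bij_betw_coord_Rd:
  "bij_betw (\<lambda>x. restrict (coord x) {..<d}) (Rd d) ({..<d} \<rightarrow>\<^sub>E UNIV)"
proof (rule bij_betwI[where g = "\<lambda>v. Abs_finseq (\<lambda>i. if i < d then v i else 0)"])
  have fin: "finite {i. (if i < d then v i else 0) \<noteq> 0}" for v :: "nat \<Rightarrow> real"
    by (rule finite_subset[of _ "{..<d}"]) auto
  have coord: "coord (Abs_finseq (\<lambda>i. if i < d then v i else 0)) = (\<lambda>i. if i < d then v i else 0)"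
    for v :: "nat \<Rightarrow> real"
    using fin[of v] by (intro Abs_finseq_inverse) simp
  show "(\<lambda>v. Abs_finseq (\<lambda>i. if i < d then v i else 0)) \<in> ({..<d} \<rightarrow>\<^sub>E UNIV) \<rightarrow> Rd d"
    by (auto simp: Rd_def coord)
  show "Abs_finseq (\<lambda>i. if i < d then restrict (coord x) {..<d} i else 0) = x" if "x \<in> Rd d" for x
    using that by (intro finseq_eqI) (auto simp: coord Rd_def)
  show "restrict (coord (Abs_finseq (\<lambda>i. if i < d then v i else 0))) {..<d} = v"
    if "v \<in> {..<d} \<rightarrow>\<^sub>E UNIV" for v
    using that by (auto simp: coord PiE_def extensional_def fun_eq_iff)
qed auto

text \<open>
  Only meant for a subspace \<open>S\<close>: the requirement \<open>g \<in> S\<close> then makes the gradient unique, while the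
  derivative within \<open>S\<close> says nothing about directions orthogonal to \<open>S\<close>.
\<close>

definition grad_on :: "'a::real_inner set \<Rightarrow> ('a \<Rightarrow> real) \<Rightarrow> 'a \<Rightarrow> 'a" where
  "grad_on S f x = (THE g. g \<in> S \<and> (f has_derivative (\<lambda>h. g \<bullet> h)) (at x within S))"

definition smooth_on_with :: "'a::real_inner set \<Rightarrow> real \<Rightarrow> ('a \<Rightarrow> real) \<Rightarrow> bool" where
  "smooth_on_with S L f \<longleftrightarrow>
     (\<forall>x\<in>S. \<forall>y\<in>S. f x - f y - grad_on S f y \<bullet> (x - y) \<le> L / 2 * (norm (x - y))\<^sup>2)"

definition prox_objective :: "real \<Rightarrow> ('a::real_inner \<Rightarrow> real) \<Rightarrow> 'a \<Rightarrow> 'a \<Rightarrow> real" where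
  "prox_objective \<gamma> f x z = f z + 1 / (2 * \<gamma>) * (norm (z - x))\<^sup>2"

definition prox_on :: "'a::real_inner set \<Rightarrow> real \<Rightarrow> ('a \<Rightarrow> real) \<Rightarrow> 'a \<Rightarrow> 'a" where
  "prox_on S \<gamma> f x = arg_min_on (prox_objective \<gamma> f x) S"

text \<open>
  The state after \<open>t\<close> steps is the pair \<open>(z\<^sub>t\<^sub>-\<^sub>1, z\<^sub>t)\<close>, with \<open>z\<^sub>-\<^sub>1 = z\<^sub>0 = x\<close>; the parameter \<open>G\<close> is
  the gradient of the objective.
\<close>

primrec agd_state ::
  "('a::real_vector \<Rightarrow> 'a) \<Rightarrow> real \<Rightarrow> real \<Rightarrow> 'a \<Rightarrow> nat \<Rightarrow> 'a \<times> 'a" where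
  "agd_state G \<eta> \<alpha> x 0 = (x, x)"
| "agd_state G \<eta> \<alpha> x (Suc t) =
     (let (z', z) = agd_state G \<eta> \<alpha> x t; y = z + \<alpha> *\<^sub>R (z - z')
      in (z, y - \<eta> *\<^sub>R G y))"

definition agd :: "('a::real_vector \<Rightarrow> 'a) \<Rightarrow> real \<Rightarrow> real \<Rightarrow> 'a \<Rightarrow> nat \<Rightarrow> 'a" where
  "agd G \<eta> \<alpha> x t = snd (agd_state G \<eta> \<alpha> x t)"

definition agd_prox ::
  "'a::real_inner set \<Rightarrow> real \<Rightarrow> real \<Rightarrow> ('a \<Rightarrow> real) \<Rightarrow> 'a \<Rightarrow> nat \<Rightarrow> 'a" where
  "agd_prox S L \<gamma> f x =
     agd (grad_on S (prox_objective \<gamma> f x))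
       (\<gamma> / (1 + \<gamma> * L)) ((sqrt (1 + \<gamma> * L) - 1) / (sqrt (1 + \<gamma> * L) + 1)) x"

text \<open>
  \<open>reached_within C Q P\<close>: \<open>P\<close> holds after some \<open>t \<le> max {0, \<lceil>C Q\<rceil>}\<close> iterations. If \<open>Q\<close> contains
  \<open>log 0 = -\<infinity>\<close>, the intended bound is \<open>t = 0\<close>; the library value \<open>ln 0 = 0\<close> gives the same.
\<close>

definition reached_within :: "real \<Rightarrow> real \<Rightarrow> (nat \<Rightarrow> bool) \<Rightarrow> bool" where
  "reached_within C Q P \<longleftrightarrow> (\<exists>t. int t \<le> max 0 \<lceil>C * Q\<rceil> \<and> P t)"

end

theory Submission
  imports Defs
begin

text \<open>
  Put \<open>q = 1 / sqrt \<kappa>\<close> with \<open>\<kappa> = 1 + \<gamma> L\<close>, the condition number of the objective \<open>A\<close>, and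
  \<open>m = 1 / \<gamma>\<close>. With \<open>v\<^sub>t = z\<^sub>t\<^sub>-\<^sub>1 + (z\<^sub>t - z\<^sub>t\<^sub>-\<^sub>1) / q\<close>, the Lyapunov function
  \<open>A z\<^sub>t - A p + m / 2 * (norm (v\<^sub>t - p))\<^sup>2\<close> at the minimiser \<open>p\<close> shrinks by the factor \<open>1 - q\<close> in
  each step. Hence \<open>(norm (z\<^sub>t - p))\<^sup>2 \<le> (1 - q) ^ t * (\<kappa> + 1) * (norm (x - p))\<^sup>2\<close>. The factor
  \<open>\<kappa> + 1\<close> in place of \<open>\<kappa>\<close> costs only a constant: either \<open>\<kappa> u \<ge> 2\<close>, where \<open>u > 1\<close> is the required
  reduction, or \<open>\<kappa> < 2\<close> and a single step suffices.
\<close>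

section \<open>Accelerated gradient descent for smooth, strongly convex functions on a
  subspace\<close>

locale strongly_convex_smooth =
  fixes S :: "'a::real_inner set" and A :: "'a \<Rightarrow> real" and G :: "'a \<Rightarrow> 'a" and m M :: real
  assumes subspace: "subspace S"
    and G_in: "y \<in> S \<Longrightarrow> G y \<in> S"
    and m_pos: "0 < m" and m_le_M: "m \<le> M"
    and lower: "\<lbrakk>x \<in> S; y \<in> S\<rbrakk> \<Longrightarrow> A y + G y \<bullet> (x - y) + m / 2 * (norm (x - y))\<^sup>2 \<le> A x"
    and upper: "\<lbrakk>x \<in> S; y \<in> S\<rbrakk> \<Longrightarrow> A x \<le> A y + G y \<bullet> (x - y) + M / 2 * (norm (x - y))\<^sup>2"
begin

lemma M_pos: "0 < M"
  using m_pos m_le_M by simp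

text \<open>The step length \<open>1 / M\<close> minimises the quadratic bound \<open>upper\<close>
  along the direction \<open>- G y\<close>.\<close>

lemma gradient_step:
  assumes "y \<in> S"
  shows "A (y - (1 / M) *\<^sub>R G y) \<le> A y - (norm (G y))\<^sup>2 / (2 * M)"
proof -
  have "y - (1 / M) *\<^sub>R G y \<in> S"
    using assms by (intro subspace_diff subspace_scale subspace G_in)
  from upper[OF this assms] show ?thesis
    using M_pos
    by (simp add: power2_norm_eq_inner[symmetric] power_mult_distrib field_simps power2_eq_square)
qed

text \<open>In the sum of the bounds \<open>lower\<close> at the midpoint the gradient terms cancel.
  Near-minimisers are therefore close together, which makes minimising sequences Cauchy.\<close>

lemma midpoint_gap:
  assumes "p \<in> S" "q \<in> S" "\<And>z. z \<in> S \<Longrightarrow> I \<le> A z"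
  shows "m / 4 * (norm (p - q))\<^sup>2 \<le> (A p - I) + (A q - I)"
proof -
  define c where "c = (1 / 2) *\<^sub>R (p + q)"
  have c: "c \<in> S" unfolding c_def using assms by (intro subspace_scale subspace_add subspace)
  have p: "p - c = (1 / 2) *\<^sub>R (p - q)" and q: "q - c = - ((1 / 2) *\<^sub>R (p - q))"
    by (simp_all add: c_def algebra_simps flip: scaleR_add_left)
  have "A c + G c \<bullet> ((1 / 2) *\<^sub>R (p - q)) + m / 8 * (norm (p - q))\<^sup>2 \<le> A p"
    using lower[OF assms(1) c] unfolding p by (simp add: power_divide)
  moreover have "A c - G c \<bullet> ((1 / 2) *\<^sub>R (p - q)) + m / 8 * (norm (p - q))\<^sup>2 \<le> A q"
    using lower[OF assms(2) c] unfolding q by (simp add: power_divide)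
  ultimately show ?thesis using assms(3)[OF c] by simp
qed

lemma minimiser_exists:
  assumes "complete S" "bdd_below (A ` S)"
  obtains p where "is_arg_min A (\<lambda>z. z \<in> S) p"
proof -
  define I where "I = Inf (A ` S)"
  have ne: "A ` S \<noteq> {}" using subspace_0[OF subspace] by auto
  have I: "I \<le> A z" if "z \<in> S" for z
    unfolding I_def using that assms(2) by (intro cInf_lower) auto
  have "\<exists>z\<in>S. A z < I + 1 / real (Suc n)" for n
    using cInf_lessD[OF ne, of "I + 1 / real (Suc n)"] unfolding I_def by auto
  then obtain X where X: "\<And>n. X n \<in> S" "\<And>n. A (X n) < I + 1 / real (Suc n)" by metis
  have "Cauchy X"
  proof (rule metric_CauchyI)
    fix e :: real assume e: "0 < e"
    \<comment> \<open>Two gaps of this size add up to \<open>m / 4 * e\<^sup>2\<close>, matching the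
      constant in \<open>midpoint_gap\<close>.\<close>
    obtain N where N: "1 / real (Suc N) < m / 8 * e\<^sup>2"
      using nat_approx_posE[of "m / 8 * e\<^sup>2"] e m_pos by auto
    have small: "A (X n) - I < m / 8 * e\<^sup>2" if "N \<le> n" for n
    proof -
      have "1 / real (Suc n) \<le> 1 / real (Suc N)" using that by (simp add: field_simps)
      then show ?thesis using X(2)[of n] N by linarith
    qed
    have "dist (X j) (X k) < e" if "N \<le> j" "N \<le> k" for j k
    proof -
      have "m / 4 * (norm (X j - X k))\<^sup>2 < m / 4 * e\<^sup>2"
        using midpoint_gap[OF X(1) X(1) I, of j k] small[OF that(1)] small[OF that(2)] by simp
      then have "(norm (X j - X k))\<^sup>2 < e\<^sup>2" using m_pos by simp
      then show ?thesis using e by (simp add: dist_norm power2_less_imp_less)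
    qed
    then show "\<exists>N. \<forall>j\<ge>N. \<forall>k\<ge>N. dist (X j) (X k) < e" by blast
  qed
  then obtain p where p: "p \<in> S" "X \<longlonglongrightarrow> p"
    using assms(1) X(1) unfolding complete_def by blast
  \<comment> \<open>Lower semicontinuity at the limit: the tangent bound at \<open>p\<close> lies
    below \<open>A (X n)\<close>, and its left side tends to \<open>A p\<close>.\<close>
  have "A p + G p \<bullet> (X n - p) \<le> I + 1 / real (Suc n)" for n
  proof -
    have "0 \<le> m / 2 * (norm (X n - p))\<^sup>2" using m_pos by simp
    then show ?thesis using lower[OF X(1)[of n] p(1)] X(2)[of n] by linarith
  qed
  moreover have "(\<lambda>n. A p + G p \<bullet> (X n - p)) \<longlonglongrightarrow> A p + G p \<bullet> (p - p)"
    by (intro tendsto_intros p)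
  moreover have "(\<lambda>n. I + 1 / real (Suc n)) \<longlonglongrightarrow> I + 0"
    by (intro tendsto_add tendsto_const LIMSEQ_Suc[OF lim_1_over_n])
  ultimately have "A p + G p \<bullet> (p - p) \<le> I + 0"
    by (intro LIMSEQ_le) auto
  then have "A p \<le> A z" if "z \<in> S" for z using I[OF that] by simp
  then show ?thesis using p(1) by (intro that[of p]) (auto simp: is_arg_min_def not_less)
qed

context
  fixes p assumes p: "is_arg_min A (\<lambda>z. z \<in> S) p"
begin

lemma p_in: "p \<in> S" and p_le: "z \<in> S \<Longrightarrow> A p \<le> A z"
  using p by (auto simp: is_arg_min_def not_less)

text \<open>A gradient step from \<open>p\<close> stays in \<open>S\<close> and would decrease
  \<open>A\<close> if \<open>G p\<close> were nonzero.\<close>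

lemma G_minimiser: "G p = 0"
proof -
  have "p - (1 / M) *\<^sub>R G p \<in> S"
    using p_in by (intro subspace_diff subspace_scale subspace G_in)
  from p_le[OF this] gradient_step[OF p_in] have "(norm (G p))\<^sup>2 / (2 * M) \<le> 0" by linarith
  then show ?thesis using M_pos by (simp add: divide_le_0_iff)
qed

text \<open>The estimate adds the descent of the gradient step, \<open>1 - q\<close> times the bound
  \<open>lower\<close> towards \<open>z\<close> and \<open>q\<close> times the one towards
  \<open>p\<close>. All gradient terms then cancel against those in the expanded square.\<close>

lemma agd_step:
  assumes q: "0 < q" "q \<le> 1" "m = q\<^sup>2 * M"
    and "z \<in> S" "y \<in> S" and zy: "z - y = - q *\<^sub>R (v - y)"
  shows "A (y - (1 / M) *\<^sub>R G y) - A p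
      + m / 2 * (norm ((1 - q) *\<^sub>R v + q *\<^sub>R y - (q / m) *\<^sub>R G y - p))\<^sup>2
    \<le> (1 - q) * (A z - A p + m / 2 * (norm (v - p))\<^sup>2)"
proof -
  define a b g where "a = v - y" and "b = y - p" and "g = G y"
  have vp: "v - p = a + b" by (simp add: a_def b_def)
  have vp': "(1 - q) *\<^sub>R v + q *\<^sub>R y - (q / m) *\<^sub>R G y - p = (1 - q) *\<^sub>R a + b - (q / m) *\<^sub>R g"
    by (simp add: a_def b_def g_def algebra_simps)
  have 1: "A (y - (1 / M) *\<^sub>R G y) \<le> A y - (g \<bullet> g) / (2 * M)"
    using gradient_step[OF assms(5)] by (simp add: g_def power2_norm_eq_inner)
  have "A y - q * (g \<bullet> a) + m / 2 * (q\<^sup>2 * (a \<bullet> a)) \<le> A z"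
    using lower[OF assms(4,5)] unfolding zy a_def g_def
    by (simp add: power_mult_distrib power2_norm_eq_inner)
  then have 2: "(1 - q) * (A y - q * (g \<bullet> a)) \<le> (1 - q) * A z"
    using q m_pos by (intro mult_left_mono) (auto intro: order_trans[rotated])
  have "p - y = - b" by (simp add: b_def)
  then have "A y - g \<bullet> b + m / 2 * (b \<bullet> b) \<le> A p"
    using lower[OF p_in assms(5)] by (simp add: g_def power2_norm_eq_inner)
  then have 3: "q * (A y - g \<bullet> b + m / 2 * (b \<bullet> b)) \<le> q * A p"
    using q by (intro mult_left_mono) auto
  \<comment> \<open>Since \<open>(1 - q) *\<^sub>R a + b\<close> is the convex combination of
    \<open>a + b\<close> and \<open>b\<close>, its squared norm is the combination of theirs minus
    \<open>q * (1 - q) * (a \<bullet> a)\<close>. The relation \<open>m = q\<^sup>2 * M\<close>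
    makes the last term equal the descent gained in \<open>1\<close>.\<close>
  have 4: "m / 2 * (norm ((1 - q) *\<^sub>R a + b - (q / m) *\<^sub>R g))\<^sup>2
    = m / 2 * ((1 - q) * (norm (a + b))\<^sup>2 + q * (b \<bullet> b) - q * (1 - q) * (a \<bullet> a))
      - q * ((1 - q) * (g \<bullet> a) + g \<bullet> b) + (g \<bullet> g) / (2 * M)"
  proof -
    have "m / 2 * (q / m)\<^sup>2 = 1 / (2 * M)"
      using q M_pos by (simp add: power2_eq_square)
    moreover have "m / 2 * (2 * (q / m)) = q" using m_pos by simp
    moreover have "(norm ((1 - q) *\<^sub>R a + b - (q / m) *\<^sub>R g))\<^sup>2
      = ((1 - q) * (norm (a + b))\<^sup>2 + q * (b \<bullet> b) - q * (1 - q) * (a \<bullet> a))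
        - 2 * (q / m) * ((1 - q) * (g \<bullet> a) + g \<bullet> b) + (q / m)\<^sup>2 * (g \<bullet> g)"
      unfolding power2_norm_eq_inner
      by (simp add: inner_simps inner_commute power2_eq_square)
        (simp add: algebra_simps add_divide_distrib diff_divide_distrib)
    moreover have "m / 2 * (X - 2 * (q / m) * Y + (q / m)\<^sup>2 * Z)
      = m / 2 * X - m / 2 * (2 * (q / m)) * Y + m / 2 * (q / m)\<^sup>2 * Z" for X Y Z
      by (simp add: algebra_simps)
    ultimately show ?thesis by simp
  qed
  have 5: "0 \<le> m / 2 * (q * (1 - q) * (a \<bullet> a))" using q m_pos by simp
  show ?thesis unfolding vp' 4 unfolding vp using 1 2 3 5
    by (simp add: algebra_simps add_divide_distrib diff_divide_distrib)
qed

text \<open>The momentum \<open>(1 - q) / (1 + q)\<close> is the one that makes \<open>y\<close> the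
  weighted mean of \<open>z\<close> and \<open>v\<close> with weights \<open>1\<close> and
  \<open>q\<close>, as \<open>agd_step\<close> demands. Membership in \<open>S\<close> is carried
  through the induction because the quadratic bounds hold only there.\<close>

lemma agd_Lyapunov:
  assumes q: "0 < q" "q \<le> 1" "m = q\<^sup>2 * M" and x: "x \<in> S"
  defines "st \<equiv> agd_state G (1 / M) ((1 - q) / (1 + q)) x"
  shows "fst (st t) \<in> S \<and> snd (st t) \<in> S \<and>
    A (snd (st t)) - A p
      + m / 2 * (norm (fst (st t) + (1 / q) *\<^sub>R (snd (st t) - fst (st t)) - p))\<^sup>2
    \<le> (1 - q) ^ t * (A x - A p + m / 2 * (norm (x - p))\<^sup>2)"
proof (induction t)
  case 0
  show ?case using x by (simp add: st_def)
next
  case (Suc t)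
  obtain z' z where st: "st t = (z', z)" by fastforce
  define v where "v = z' + (1 / q) *\<^sub>R (z - z')"
  define y where "y = z + ((1 - q) / (1 + q)) *\<^sub>R (z - z')"
  have st': "st (Suc t) = (z, y - (1 / M) *\<^sub>R G y)"
    using st by (simp add: st_def y_def Let_def)
  have z: "z' \<in> S" "z \<in> S" using Suc st by auto
  then have y: "y \<in> S" unfolding y_def by (intro subspace_add subspace_scale subspace_diff subspace)
  have y': "y - (1 / M) *\<^sub>R G y \<in> S"
    using y by (intro subspace_diff subspace_scale subspace G_in)
  have qv': "q *\<^sub>R v = q *\<^sub>R z' + (z - z')" using q by (simp add: v_def scaleR_add_right)
  have "(1 + q) *\<^sub>R y = (1 + q) *\<^sub>R z + (1 - q) *\<^sub>R (z - z')"
    using q by (simp add: y_def scaleR_add_right)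
  also have "\<dots> = z + q *\<^sub>R v"
    unfolding qv' by (simp add: algebra_simps)
  finally have "(1 + q) *\<^sub>R y = z + q *\<^sub>R v" .
  then have zy: "z - y = - q *\<^sub>R (v - y)"
    by (simp add: algebra_simps)
  have qv: "(1 / q) *\<^sub>R (y - z) = v - y"
  proof -
    have "y - z = q *\<^sub>R (v - y)" using zy by (simp add: algebra_simps)
    then show ?thesis using q by simp
  qed
  have "(1 / M) / q = q / m" using q M_pos by (simp add: power2_eq_square)
  then have vy: "(1 / q) *\<^sub>R (y - (1 / M) *\<^sub>R G y - z) = v - y - (q / m) *\<^sub>R G y"
    using qv by (simp add: algebra_simps)
  have z_eq: "z = y - q *\<^sub>R (v - y)" using zy by (simp add: algebra_simps)
  \<comment> \<open>Extrapolating the new pair of iterates by \<open>1 / q\<close> gives exactly the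
    vector whose distance to \<open>p\<close> is controlled by \<open>agd_step\<close>.\<close>
  have v': "z + (1 / q) *\<^sub>R (y - (1 / M) *\<^sub>R G y - z) =
      (1 - q) *\<^sub>R v + q *\<^sub>R y - (q / m) *\<^sub>R G y"
    by (subst vy, subst z_eq) (simp add: algebra_simps)
  have IH: "A z - A p + m / 2 * (norm (v - p))\<^sup>2
      \<le> (1 - q) ^ t * (A x - A p + m / 2 * (norm (x - p))\<^sup>2)"
    using Suc st by (simp add: v_def)
  from agd_step[OF q z(2) y zy] mult_left_mono[OF IH, of "1 - q"] q(2)
  show ?case unfolding st' fst_conv snd_conv v' by (simp add: z y' mult.assoc)
qed

text \<open>Because \<open>G p = 0\<close>, the gap of \<open>A\<close> lies between
  \<open>m / 2\<close> and \<open>M / 2\<close> times the squared distance to \<open>p\<close>. The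
  initial Lyapunov value thus contributes the factor \<open>M / m + 1\<close>, which is
  \<open>1 / q\<^sup>2 + 1\<close>.\<close>

lemma agd_dist:
  assumes q: "0 < q" "q \<le> 1" "m = q\<^sup>2 * M" and x: "x \<in> S"
  shows "(norm (agd G (1 / M) ((1 - q) / (1 + q)) x t - p))\<^sup>2
    \<le> (1 - q) ^ t * (1 / q\<^sup>2 + 1) * (norm (x - p))\<^sup>2"
proof -
  let ?z = "agd G (1 / M) ((1 - q) / (1 + q)) x t" and ?D = "(norm (x - p))\<^sup>2"
  define P where "P = (1 - q) ^ t"
  have P: "0 \<le> P" using q by (simp add: P_def)
  have z: "?z \<in> S" and L: "A ?z - A p \<le> P * (A x - A p + m / 2 * ?D)"
  proof -
    note L = agd_Lyapunov[OF q x, of t, folded agd_def P_def]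
    then show "?z \<in> S" by blast
    have "0 \<le> m / 2 * (norm w)\<^sup>2" for w :: 'a using m_pos by simp
    with L show "A ?z - A p \<le> P * (A x - A p + m / 2 * ?D)"
      by (meson add_increasing2 order_refl order_trans)
  qed
  have "m / 2 * (norm (?z - p))\<^sup>2 \<le> A ?z - A p"
    using lower[OF z p_in] by (simp add: G_minimiser)
  also note L
  also have "P * (A x - A p + m / 2 * ?D) \<le> P * (M / 2 * ?D + m / 2 * ?D)"
    using upper[OF x p_in] P by (intro mult_left_mono) (simp_all add: G_minimiser)
  also have "\<dots> = m / 2 * (P * (1 / q\<^sup>2 + 1) * ?D)"
    using q by (simp add: field_simps)
  finally show ?thesis using m_pos by (simp add: P_def)
qed

end

end

section \<open>Gradients and tangent bounds within a subspace\<close>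

lemma has_derivative_line:
  assumes "subspace S" "(f has_derivative (\<lambda>h. g \<bullet> h)) (at x within S)" "x \<in> S" "h \<in> S"
  shows "((\<lambda>t. f (x + t *\<^sub>R h)) has_real_derivative g \<bullet> h) (at 0)"
proof -
  have "((\<lambda>t. x + t *\<^sub>R h) has_derivative (\<lambda>t. t *\<^sub>R h)) (at 0)"
    by (auto intro!: derivative_eq_intros)
  moreover have "(f has_derivative (\<lambda>h. g \<bullet> h)) (at (x + 0 *\<^sub>R h) within range (\<lambda>t. x + t *\<^sub>R h))"
    using assms by (auto intro!: has_derivative_subset[OF assms(2)] subspace_add subspace_scale)
  ultimately show ?thesis
    using has_derivative_in_compose[of "\<lambda>t. x + t *\<^sub>R h" "\<lambda>t. t *\<^sub>R h" 0 UNIV f "\<lambda>h. g \<bullet> h"]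
    by (simp add: has_field_derivative_def mult_commute_abs)
qed

text \<open>The difference of two candidates lies in \<open>S\<close>, so it is itself an admissible
  direction; comparing the derivatives along it shows that its squared norm is zero.\<close>

lemma grad_on_eq:
  assumes "subspace S" "(f has_derivative (\<lambda>h. g \<bullet> h)) (at x within S)" "x \<in> S" "g \<in> S"
  shows "grad_on S f x = g"
  unfolding grad_on_def
proof (rule the_equality)
  fix g' assume g': "g' \<in> S \<and> (f has_derivative (\<lambda>h. g' \<bullet> h)) (at x within S)"
  have h: "g' - g \<in> S" using assms g' by (intro subspace_diff) auto
  have "g' \<bullet> (g' - g) = g \<bullet> (g' - g)"
    using g' assms h by (intro DERIV_unique[OF has_derivative_line has_derivative_line]) auto
  then have "(g' - g) \<bullet> (g' - g) = 0" by (simp add: inner_diff_left)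
  then show "g' = g" by simp
qed (use assms in auto)

text \<open>By convexity the difference quotients from \<open>y\<close> towards \<open>x\<close> are
  at most \<open>f x - f y\<close>; their limit at 0 from the right is the directional
  derivative.\<close>

lemma convex_on_above_tangent:
  fixes f :: "'a::real_inner \<Rightarrow> real"
  assumes "subspace S" "convex_on S f" "(f has_derivative (\<lambda>h. g \<bullet> h)) (at y within S)"
    "x \<in> S" "y \<in> S"
  shows "f y + g \<bullet> (x - y) \<le> f x"
proof -
  have "((\<lambda>t. f (y + t *\<^sub>R (x - y))) has_real_derivative g \<bullet> (x - y)) (at 0)"
    using assms by (intro has_derivative_line subspace_diff)
  then have "((\<lambda>t. (f (y + t *\<^sub>R (x - y)) - f y) / t) \<longlongrightarrow> g \<bullet> (x - y)) (at_right 0)"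
    unfolding DERIV_def by (auto intro: tendsto_mono at_le)
  moreover have "\<forall>\<^sub>F t in at_right 0. (f (y + t *\<^sub>R (x - y)) - f y) / t \<le> f x - f y"
  proof (rule eventually_at_rightI[of 0 1])
    fix t :: real assume t: "t \<in> {0<..<1}"
    have "f ((1 - t) *\<^sub>R y + t *\<^sub>R x) \<le> (1 - t) * f y + t * f x"
      using t assms by (intro convex_onD) auto
    moreover have "(1 - t) *\<^sub>R y + t *\<^sub>R x = y + t *\<^sub>R (x - y)" by (simp add: algebra_simps)
    ultimately show "(f (y + t *\<^sub>R (x - y)) - f y) / t \<le> f x - f y"
      using t by (simp add: field_simps)
  qed simp
  ultimately have "g \<bullet> (x - y) \<le> f x - f y"
    by (intro tendsto_upperbound) auto
  then show ?thesis by simp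
qed

section \<open>Coordinates, completeness and existence of gradients in \<open>Rd d\<close>\<close>

definition unit_seq :: "nat \<Rightarrow> finseq" where
  "unit_seq i = Abs_finseq (\<lambda>j. if j = i then 1 else 0)"

lemma coord_unit_seq: "coord (unit_seq i) j = (if j = i then 1 else 0)"
  unfolding unit_seq_def by (subst Abs_finseq_inverse) auto

lemma coord_sum: "coord (\<Sum>i\<in>I. h i) j = (\<Sum>i\<in>I. coord (h i) j)"
  by (induction I rule: infinite_finite_induct) auto

lemma Rd_expansion: "x \<in> Rd d \<Longrightarrow> (\<Sum>i<d. coord x i *\<^sub>R unit_seq i) = x"
  by (intro finseq_eqI) (auto simp: coord_sum coord_unit_seq Rd_def if_distrib cong: if_cong)

lemma sum_unit_seq_in_Rd: "(\<Sum>i<d. c i *\<^sub>R unit_seq i) \<in> Rd d"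
  by (auto simp: Rd_def coord_sum coord_unit_seq intro!: sum.neutral)

lemma abs_coord_le_norm: "\<bar>coord x i\<bar> \<le> norm x"
proof -
  have "x \<bullet> unit_seq i = coord x i"
    by (subst inner_commute) (simp add: inner_finseq_def coord_unit_seq cong: if_cong)
  moreover have "norm (unit_seq i) = 1"
    by (simp add: norm_finseq_def inner_finseq_def coord_unit_seq cong: if_cong)
  ultimately show ?thesis using Cauchy_Schwarz_ineq2[of x "unit_seq i"] by simp
qed

text \<open>The ambient space \<open>finseq\<close> is not complete. For fixed \<open>d\<close>,
  coordinatewise limits suffice, since every term is a combination of the same \<open>d\<close> unit
  sequences.\<close>

lemma complete_Rd: "complete (Rd d)"
  unfolding complete_def
proof (intro allI impI, elim conjE)
  fix X :: "nat \<Rightarrow> finseq" assume X: "\<forall>n. X n \<in> Rd d" "Cauchy X"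
  have "Cauchy (\<lambda>n. coord (X n) i)" for i
  proof (rule metric_CauchyI)
    fix e :: real assume "0 < e"
    then obtain N where "\<And>j k. N \<le> j \<Longrightarrow> N \<le> k \<Longrightarrow> dist (X j) (X k) < e"
      using metric_CauchyD[OF X(2)] by meson
    moreover have "dist (coord (X j) i) (coord (X k) i) \<le> dist (X j) (X k)" for j k
      using abs_coord_le_norm[of "X j - X k" i] by (simp add: dist_norm)
    ultimately show "\<exists>N. \<forall>j\<ge>N. \<forall>k\<ge>N. dist (coord (X j) i) (coord (X k) i) < e"
      by (meson le_less_trans)
  qed
  then obtain c where c: "\<And>i. (\<lambda>n. coord (X n) i) \<longlonglongrightarrow> c i"
    unfolding Cauchy_convergent_iff convergent_def by metis
  have "(\<lambda>n. \<Sum>i<d. coord (X n) i *\<^sub>R unit_seq i) \<longlonglongrightarrow> (\<Sum>i<d. c i *\<^sub>R unit_seq i)"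
    by (intro tendsto_intros c)
  then have "X \<longlonglongrightarrow> (\<Sum>i<d. c i *\<^sub>R unit_seq i)" using X(1) by (simp add: Rd_expansion)
  then show "\<exists>l\<in>Rd d. X \<longlonglongrightarrow> l" using sum_unit_seq_in_Rd by blast
qed

text \<open>A derivative \<open>D\<close> within \<open>Rd d\<close> is arbitrary in orthogonal
  directions. The vector \<open>g\<close> is built from the values of \<open>D\<close> on the first
  \<open>d\<close> unit sequences only, hence lies in \<open>Rd d\<close> and represents
  \<open>D\<close> there.\<close>

lemma has_derivative_grad_on_Rd:
  assumes "f differentiable_on Rd d" "x \<in> Rd d"
  shows "(f has_derivative (\<lambda>h. grad_on (Rd d) f x \<bullet> h)) (at x within Rd d)"
    and "grad_on (Rd d) f x \<in> Rd d"
proof -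
  obtain D where D: "(f has_derivative D) (at x within Rd d)"
    using assms unfolding differentiable_on_def differentiable_def by blast
  interpret D: bounded_linear D using D by (rule has_derivative_bounded_linear)
  define g where "g = (\<Sum>i<d. D (unit_seq i) *\<^sub>R unit_seq i)"
  have g: "g \<in> Rd d" unfolding g_def by (rule sum_unit_seq_in_Rd)
  have "D h = g \<bullet> h" if "h \<in> Rd d" for h
  proof -
    have "D h = (\<Sum>i<d. coord h i * D (unit_seq i))"
      by (subst Rd_expansion[OF that, symmetric]) (simp add: D.sum D.scaleR)
    also have "\<dots> = g \<bullet> h"
      unfolding inner_Rd[OF g]
      by (intro sum.cong) (auto simp: g_def coord_sum coord_unit_seq if_distrib cong: if_cong)
    finally show ?thesis .
  qed
  then have "D (y - x) = g \<bullet> (y - x)" if "y \<in> Rd d" for y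
    using that assms(2) by (simp add: subspace_diff subspace_Rd)
  moreover have "bounded_linear (\<lambda>h. g \<bullet> h)" by (rule bounded_linear_inner_right)
  ultimately have "(f has_derivative (\<lambda>h. g \<bullet> h)) (at x within Rd d)"
    using D unfolding has_derivative_within' by simp
  with grad_on_eq[OF subspace_Rd this assms(2) g] g
  show "(f has_derivative (\<lambda>h. grad_on (Rd d) f x \<bullet> h)) (at x within Rd d)"
    "grad_on (Rd d) f x \<in> Rd d" by auto
qed

section \<open>The proximal objective and its minimiser\<close>

lemma prox_objective_strongly_convex_smooth:
  assumes f: "f differentiable_on Rd d" "convex_on (Rd d) f" "smooth_on_with (Rd d) L f"
    and "0 < L" "0 < \<gamma>" and x: "x \<in> Rd d"
  shows "strongly_convex_smooth (Rd d) (prox_objective \<gamma> f x)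
    (grad_on (Rd d) (prox_objective \<gamma> f x)) (1 / \<gamma>) (L + 1 / \<gamma>)"
proof -
  let ?A = "prox_objective \<gamma> f x" and ?g = "grad_on (Rd d) f"
  have G: "grad_on (Rd d) ?A y = ?g y + (1 / \<gamma>) *\<^sub>R (y - x)" if y: "y \<in> Rd d" for y
  proof (rule grad_on_eq[OF subspace_Rd _ y])
    show "?g y + (1 / \<gamma>) *\<^sub>R (y - x) \<in> Rd d"
      using has_derivative_grad_on_Rd(2)[OF f(1) y] x y
      by (intro subspace_add subspace_scale subspace_diff subspace_Rd)
    show "(?A has_derivative (\<lambda>h. (?g y + (1 / \<gamma>) *\<^sub>R (y - x)) \<bullet> h)) (at y within Rd d)"
      unfolding prox_objective_def power2_norm_eq_inner
      by (rule derivative_eq_intros has_derivative_grad_on_Rd(1)[OF f(1) y] refl)+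
         (simp add: fun_eq_iff inner_add_left inner_diff_left inner_diff_right inner_add_right inner_commute
           diff_divide_distrib)
  qed
  \<comment> \<open>The proximal term equals its second-order expansion and adds
    \<open>1 / \<gamma>\<close> to the curvature \<open>c\<close>. Taking \<open>c = 0\<close>
    reduces strong convexity to the tangent bound for \<open>f\<close>, and \<open>c = L\<close>
    reduces smoothness to that of \<open>f\<close>.\<close>
  have expand: "?A y + (?g y + (1 / \<gamma>) *\<^sub>R (y - x)) \<bullet> (z - y) + (c + 1 / \<gamma>) / 2 * (norm (z - y))\<^sup>2
      = f y + ?g y \<bullet> (z - y) + c / 2 * (norm (z - y))\<^sup>2 + (?A z - f z)" for y z c
  proof -
    have "(norm (z - x))\<^sup>2 = (norm (y - x))\<^sup>2 + 2 * ((y - x) \<bullet> (z - y)) + (norm (z - y))\<^sup>2"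
      unfolding power2_norm_eq_inner by (simp add: inner_simps inner_commute)
    then show ?thesis
      unfolding prox_objective_def by (simp only:)
        (simp add: inner_add_left algebra_simps add_divide_distrib)
  qed
  show ?thesis
  proof
    fix y assume y: "y \<in> Rd d"
    show "grad_on (Rd d) ?A y \<in> Rd d"
      unfolding G[OF y] using has_derivative_grad_on_Rd(2)[OF f(1) y] x y
      by (intro subspace_add subspace_scale subspace_diff subspace_Rd)
    fix z assume z: "z \<in> Rd d"
    show "?A y + grad_on (Rd d) ?A y \<bullet> (z - y) + 1 / \<gamma> / 2 * (norm (z - y))\<^sup>2 \<le> ?A z"
      using expand[of y z 0] unfolding G[OF y]
      using convex_on_above_tangent[OF subspace_Rd f(2) has_derivative_grad_on_Rd(1)[OF f(1) y] z y]
      by simp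
    show "?A z \<le> ?A y + grad_on (Rd d) ?A y \<bullet> (z - y) + (L + 1 / \<gamma>) / 2 * (norm (z - y))\<^sup>2"
    proof -
      have "f z - f y - ?g y \<bullet> (z - y) \<le> L / 2 * (norm (z - y))\<^sup>2"
        using f(3) y z unfolding smooth_on_with_def by blast
      then show ?thesis unfolding G[OF y] expand by simp
    qed
  qed (use assms subspace_Rd in auto)
qed

lemma agd_prox_dist:
  assumes f: "f differentiable_on Rd d" "bdd_below (f ` Rd d)" "convex_on (Rd d) f"
      "smooth_on_with (Rd d) L f"
    and pos: "0 < L" "0 < \<gamma>" and x: "x \<in> Rd d"
  shows "(norm (agd_prox (Rd d) L \<gamma> f x t - prox_on (Rd d) \<gamma> f x))\<^sup>2
    \<le> (1 - 1 / sqrt (1 + \<gamma> * L)) ^ t * (1 + \<gamma> * L + 1) * (norm (x - prox_on (Rd d) \<gamma> f x))\<^sup>2"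
proof -
  let ?A = "prox_objective \<gamma> f x"
  define s q where "s = sqrt (1 + \<gamma> * L)" and "q = 1 / s"
  interpret strongly_convex_smooth "Rd d" ?A "grad_on (Rd d) ?A" "1 / \<gamma>" "L + 1 / \<gamma>"
    using assms by (intro prox_objective_strongly_convex_smooth)
  obtain b where b: "\<And>z. z \<in> Rd d \<Longrightarrow> b \<le> f z" using f(2) unfolding bdd_below_def by blast
  have "bdd_below (?A ` Rd d)"
    using b pos by (intro bdd_belowI[of _ b]) (auto simp: prox_objective_def intro!: add_increasing2)
  \<comment> \<open>\<open>prox_on\<close> is a choice of minimiser and is meaningful only once one
    exists.\<close>
  then have p: "is_arg_min ?A (\<lambda>z. z \<in> Rd d) (prox_on (Rd d) \<gamma> f x)"
    unfolding prox_on_def arg_min_on_def arg_min_def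
    using minimiser_exists[OF complete_Rd] by (metis someI_ex)
  have s: "1 < s" "s\<^sup>2 = 1 + \<gamma> * L" using pos by (auto simp: s_def)
  have "\<gamma> / (1 + \<gamma> * L) = 1 / (L + 1 / \<gamma>)" using pos by (simp add: field_simps)
  moreover have "(s - 1) / (s + 1) = (1 - q) / (1 + q)" using s(1) by (simp add: q_def divide_simps)
  moreover have "1 / q\<^sup>2 = 1 + \<gamma> * L" using s(2) by (simp add: q_def power_divide)
  moreover have "1 / \<gamma> = q\<^sup>2 * (L + 1 / \<gamma>)"
  proof -
    have "1 / \<gamma> = (1 + \<gamma> * L) / s\<^sup>2 / \<gamma>" using s by (metis div_self less_1_mult not_one_less_zero power2_eq_square)
    also have "\<dots> = q\<^sup>2 * (L + 1 / \<gamma>)" using pos by (simp add: q_def power_divide field_simps)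
    finally show ?thesis .
  qed
  ultimately show ?thesis
    using agd_dist[OF p _ _ _ x, of q t] s(1)
    by (simp add: agd_prox_def q_def flip: s_def)
qed

section \<open>From geometric decay to iteration counts\<close>

text \<open>For \<open>\<kappa> * u\<close> at least 2, the constant 2 makes the decay reach the
  inverse square of \<open>\<kappa> * u\<close>, and the spare factor absorbs the excess of
  \<open>\<kappa> + 1\<close> over \<open>\<kappa>\<close>.\<close>

lemma iterations_suffice:
  fixes \<kappa> u :: real
  assumes "1 < \<kappa>" "1 < u"
  shows "(1 - 1 / sqrt \<kappa>) ^ nat \<lceil>2 * (sqrt \<kappa> * ln (\<kappa> * u))\<rceil> * (\<kappa> + 1) * u \<le> 1"
proof -
  define q where "q = 1 / sqrt \<kappa>"
  define t where "t = nat \<lceil>2 * (sqrt \<kappa> * ln (\<kappa> * u))\<rceil>"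
  have q: "0 < q" "q < 1" "\<kappa> = 1 / q\<^sup>2" using assms by (auto simp: q_def power_divide)
  have ku: "1 < \<kappa> * u" using assms less_1_mult by blast
  have t: "2 * (sqrt \<kappa> * ln (\<kappa> * u)) \<le> real t" unfolding t_def by linarith
  moreover have "0 < 2 * (sqrt \<kappa> * ln (\<kappa> * u))" using assms ku by simp
  ultimately have "1 \<le> t" by linarith
  have "(1 - q) ^ t * (\<kappa> + 1) * u \<le> 1"
  proof (cases "2 \<le> \<kappa> * u")
    case True
    have "2 * ln (\<kappa> * u) \<le> q * real t"
      using t assms by (simp add: q_def field_simps)
    then have "- (q * real t) \<le> - ln ((\<kappa> * u)\<^sup>2)" using ku by (simp add: ln_realpow)
    then have "exp (- (q * real t)) \<le> exp (- ln ((\<kappa> * u)\<^sup>2))" by simp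
    also have "\<dots> = 1 / (\<kappa> * u)\<^sup>2" using assms by (simp add: exp_minus inverse_eq_divide)
    finally have "exp (- (q * real t)) \<le> 1 / (\<kappa> * u)\<^sup>2" .
    moreover have "(1 - q) ^ t \<le> exp (- q) ^ t"
      using q exp_ge_add_one_self[of "- q"] by (intro power_mono) auto
    then have "(1 - q) ^ t \<le> exp (- (q * real t))"
      by (simp add: exp_of_nat_mult[symmetric] mult.commute)
    ultimately have "(1 - q) ^ t \<le> 1 / (\<kappa> * u)\<^sup>2" by simp
    moreover have "(\<kappa> + 1) * u \<le> (\<kappa> * u)\<^sup>2"
    proof -
      have "(\<kappa> + 1) * u \<le> (2 * \<kappa>) * u" using assms by (intro mult_right_mono) auto
      also have "\<dots> \<le> (\<kappa> * u) * (\<kappa> * u)" using mult_right_mono[OF True, of "\<kappa> * u"] ku by simp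
      finally show ?thesis by (simp add: power2_eq_square)
    qed
    ultimately have "(1 - q) ^ t * ((\<kappa> + 1) * u) \<le> 1 / (\<kappa> * u)\<^sup>2 * (\<kappa> * u)\<^sup>2"
      using q assms by (intro mult_mono) auto
    then show ?thesis using assms by (simp add: mult.assoc)
  next
    case False
    have "\<kappa> * 1 < \<kappa> * u" using assms by (intro mult_strict_left_mono) auto
    with False have "\<kappa> < 2" by simp
    then have "1 / 2 < q\<^sup>2" using q by (simp add: field_simps)
    then have "0.7 < q" using q by (intro power2_less_imp_less[of "0.7"]) (auto simp: power2_eq_square)
    \<comment> \<open>One step leaves this factor times \<open>\<kappa> * u\<close>, which is below
      2. If \<open>q\<^sup>2\<close> is at most 2/3, the product is at most 3/10 times 5/3;
      otherwise \<open>q\<close> exceeds 3/4 and 1/4 times 2 is enough.\<close>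
    have "(1 - q) * (1 + q\<^sup>2) \<le> 1 / 2"
    proof -
      have "(1 - q) * (1 + q\<^sup>2) \<le> (3 / 10) * (1 + q\<^sup>2)" if "q\<^sup>2 \<le> 2 / 3"
        using \<open>0.7 < q\<close> by (intro mult_right_mono) auto
      moreover have "(1 - q) * (1 + q\<^sup>2) \<le> (1 - q) * 2"
        using q by (intro mult_left_mono) (auto simp: power_le_one)
      moreover have "3 / 4 < q" if "\<not> q\<^sup>2 \<le> 2 / 3"
        using that q by (intro power2_less_imp_less[of "3 / 4"]) (auto simp: power2_eq_square)
      ultimately show ?thesis by (cases "q\<^sup>2 \<le> 2 / 3") auto
    qed
    moreover have "(1 - q) ^ t \<le> (1 - q) ^ 1"
      using q \<open>1 \<le> t\<close> by (intro power_decreasing) auto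
    then have "(1 - q) ^ t * ((\<kappa> + 1) * u) \<le> (1 - q) * ((\<kappa> + 1) * u)"
      using assms by (intro mult_right_mono) auto
    moreover have "(1 - q) * ((\<kappa> + 1) * u) = (1 - q) * (1 + q\<^sup>2) * (\<kappa> * u)"
    proof -
      have "(1 + q\<^sup>2) * \<kappa> = \<kappa> + 1" using q(1) unfolding q(3) by (simp add: field_simps)
      then show ?thesis by (simp flip: mult.assoc)
    qed
    moreover have "(1 - q) * (1 + q\<^sup>2) * (\<kappa> * u) \<le> 1 / 2 * 2"
      using calculation(1) False assms q by (intro mult_mono) auto
    ultimately show ?thesis by (simp add: mult.assoc)
  qed
  then show ?thesis by (simp add: q_def t_def)
qed

lemma reached_within_of_decay:
  fixes e :: "nat \<Rightarrow> real"
  assumes "1 < \<kappa>" "0 < \<epsilon>" "e 0 = D"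
    and decay: "\<And>t. e t \<le> (1 - 1 / sqrt \<kappa>) ^ t * (\<kappa> + 1) * D"
  shows "reached_within 2 (sqrt \<kappa> * ln (\<kappa> * D / \<epsilon>)) (\<lambda>t. e t \<le> \<epsilon>)"
proof (cases "D \<le> \<epsilon>")
  \<comment> \<open>This includes \<open>D = 0\<close>, where the logarithm would be taken at 0; the
    starting point already meets the target.\<close>
  case True
  then show ?thesis using assms(3) unfolding reached_within_def by (intro exI[of _ 0]) auto
next
  case False
  define t where "t = nat \<lceil>2 * (sqrt \<kappa> * ln (\<kappa> * (D / \<epsilon>)))\<rceil>"
  have "1 < D / \<epsilon>" using False assms by simp
  then have "(1 - 1 / sqrt \<kappa>) ^ t * (\<kappa> + 1) * (D / \<epsilon>) \<le> 1"
    unfolding t_def using assms by (intro iterations_suffice)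
  then have "(1 - 1 / sqrt \<kappa>) ^ t * (\<kappa> + 1) * D \<le> \<epsilon>"
    using assms by (simp add: pos_divide_le_eq)
  then have "e t \<le> \<epsilon>" using decay[of t] by linarith
  then show ?thesis unfolding reached_within_def by (intro exI[of _ t]) (auto simp: t_def)
qed

theorem theorem5:
  shows "\<exists>C::real. C > 0 \<and>
    (\<forall>(d::nat) (f :: finseq \<Rightarrow> real) (L::real) (\<gamma>::real) (x::finseq).
      f differentiable_on Rd d \<and> bdd_below (f ` Rd d) \<and> convex_on (Rd d) f \<and>
      0 < L \<and> smooth_on_with (Rd d) L f \<and> 0 < \<gamma> \<and> x \<in> Rd d \<longrightarrow>
      (\<forall>\<epsilon>\<^sub>1>0.
        reached_within C
          (sqrt (1 + \<gamma> * L) *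
            ln ((1 + \<gamma> * L) * (norm (x - prox_on (Rd d) \<gamma> f x))\<^sup>2 / \<epsilon>\<^sub>1))
          (\<lambda>t. (norm (agd_prox (Rd d) L \<gamma> f x t - prox_on (Rd d) \<gamma> f x))\<^sup>2 \<le> \<epsilon>\<^sub>1)) \<and>
      (\<forall>\<epsilon>\<^sub>2. 0 < \<epsilon>\<^sub>2 \<and> \<epsilon>\<^sub>2 < 1 \<longrightarrow>
        reached_within C
          (sqrt (1 + \<gamma> * L) * ln ((1 + \<gamma> * L) / \<epsilon>\<^sub>2))
          (\<lambda>t. (norm (agd_prox (Rd d) L \<gamma> f x t - prox_on (Rd d) \<gamma> f x))\<^sup>2
                 \<le> \<epsilon>\<^sub>2 * (norm (x - prox_on (Rd d) \<gamma> f x))\<^sup>2)))"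
proof (intro exI[of _ 2] conjI allI impI)
  fix d :: nat and f :: "finseq \<Rightarrow> real" and L \<gamma> :: real and x :: finseq
  assume H: "f differentiable_on Rd d \<and> bdd_below (f ` Rd d) \<and> convex_on (Rd d) f \<and>
      0 < L \<and> smooth_on_with (Rd d) L f \<and> 0 < \<gamma> \<and> x \<in> Rd d"
  let ?p = "prox_on (Rd d) \<gamma> f x" and ?\<kappa> = "1 + \<gamma> * L"
  define D where "D = (norm (x - ?p))\<^sup>2"
  define e where "e t = (norm (agd_prox (Rd d) L \<gamma> f x t - ?p))\<^sup>2" for t
  have \<kappa>: "1 < ?\<kappa>" using H by simp
  have e0: "e 0 = D" by (simp add: e_def D_def agd_prox_def agd_def)
  have decay: "e t \<le> (1 - 1 / sqrt ?\<kappa>) ^ t * (?\<kappa> + 1) * D" for t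
    unfolding e_def D_def using H by (intro agd_prox_dist) auto
  note reached = reached_within_of_decay[OF \<kappa> _ e0 decay, unfolded e_def D_def]
  {
    fix \<epsilon>\<^sub>1 :: real assume "0 < \<epsilon>\<^sub>1"
    then show "reached_within 2 (sqrt ?\<kappa> * ln (?\<kappa> * (norm (x - ?p))\<^sup>2 / \<epsilon>\<^sub>1))
      (\<lambda>t. (norm (agd_prox (Rd d) L \<gamma> f x t - ?p))\<^sup>2 \<le> \<epsilon>\<^sub>1)"
      by (rule reached)
  }
  {
    fix \<epsilon>\<^sub>2 :: real assume \<epsilon>: "0 < \<epsilon>\<^sub>2 \<and> \<epsilon>\<^sub>2 < 1"
    show "reached_within 2 (sqrt ?\<kappa> * ln (?\<kappa> / \<epsilon>\<^sub>2))
      (\<lambda>t. (norm (agd_prox (Rd d) L \<gamma> f x t - ?p))\<^sup>2 \<le> \<epsilon>\<^sub>2 * (norm (x - ?p))\<^sup>2)"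
    \<comment> \<open>For \<open>D = 0\<close> the target \<open>\<epsilon>\<^sub>2 * D\<close> is
      not positive, so \<open>reached\<close> does not apply, but \<open>t = 0\<close> works.
      Otherwise \<open>D\<close> cancels inside the logarithm when \<open>reached\<close> is used
      with this target.\<close>
    proof (cases "D = 0")
      case True
      then show ?thesis
        using e0 unfolding reached_within_def by (intro exI[of _ 0]) (auto simp: e_def D_def)
    next
      case False
      then have "0 < D" by (simp add: D_def)
      then show ?thesis
        using reached[of "\<epsilon>\<^sub>2 * D"] \<epsilon> by (simp add: D_def)
    qed
  }
qed simp

end
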